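(* Let $n \ge 0$ and let $P \in \mathbb{C}[x_0,x_1,\ldots,x_n]$. If $D_{\mathcal T}(P)=0$, then $P(T_0(x),T_1(x),\ldots,T_n(x))$ is a constant (independent of $x$). If $D_{\mathcal U}(P)=0$, then $P(U_0(x),U_1(x),\ldots,U_n(x))$ is a constant (independent of $x$).
   Context: The Chebyshev polynomials of the first kind $T_n(x)$ and of the second kind $U_n(x)$ are defined by $\frac{1-xt}{1-2xt+t^2}=\sum_{n\ge 0}T_n(x)t^n$ and $\frac{1}{1-2xt+t^2}=\sum_{n\ge 0}U_n(x)t^n$. A derivation of $\mathbb{C}[x_0,\ldots,x_n]$ is a $\mathbb{C}$-linear map $D$ with $D(fg)=D(f)g+fD(g)$; it is determined by its values on the variables. The Chebyshev first kind derivation $D_{\mathcal T}$ and the Chebyshev second kind derivation $D_{\mathcal U}$ of $\mathbb{C}[x_0,\ldots,x_n]$ are given by $D_{\mathcal T}(x_0)=D_{\mathcal U}(x_0)=0$ and, for $1\le m\le n$, $$D_{\mathcal T}(x_m)=m\left(\sum_{k=1}^{m-1}\left(1-(-1)^k\right)x_{m-k}+\frac{1-(-1)^m}{2}x_0\right),\qquad D_{\mathcal U}(x_m)=\sum_{k=0}^{m-1}\left(1+(-1)^{m-k+1}\right)(k+1)x_k .$$ *)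

theory Defs
  imports
    Complex_Main
    "HOL-Library.Poly_Mapping"
    "HOL-Computational_Algebra.Polynomial"
    "HOL-Computational_Algebra.Formal_Power_Series"
begin

text \<open>
  Polynomials over the complex numbers in the variables \<open>x\<^sub>0, x\<^sub>1, \<dots>\<close>: finitely supported maps
  from monomials to coefficients, a monomial being the finitely supported map from variable
  indices to exponents. Multiplication is convolution, from \<open>HOL-Library.Poly_Mapping\<close>.
\<close>

type_synonym cmpoly = "(nat \<Rightarrow>\<^sub>0 nat) \<Rightarrow>\<^sub>0 complex"

definition Cst :: "complex \<Rightarrow> cmpoly" where
  "Cst c = Poly_Mapping.single 0 c"

definition Var :: "nat \<Rightarrow> cmpoly" where
  "Var i = Poly_Mapping.single (Poly_Mapping.single i 1) 1"

definition mpolys :: "nat \<Rightarrow> cmpoly set" where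
  "mpolys n = {P. \<forall>m \<in> Poly_Mapping.keys P. Poly_Mapping.keys m \<subseteq> {0..n}}"

text \<open>Substitution of \<open>a i\<close> for \<open>x\<^sub>i\<close>, where \<open>h\<close> embeds the scalars into the target ring.\<close>

definition mpoly_eval ::
  "(complex \<Rightarrow> 'a::comm_ring_1) \<Rightarrow> (nat \<Rightarrow> 'a) \<Rightarrow> cmpoly \<Rightarrow> 'a" where
  "mpoly_eval h a P = (\<Sum>m \<in> Poly_Mapping.keys P.
     h (Poly_Mapping.lookup P m) * (\<Prod>i \<in> Poly_Mapping.keys m. a i ^ Poly_Mapping.lookup m i))"

text \<open>Derivations of the subring \<open>mpolys n\<close>; values outside of it are irrelevant.\<close>

definition mpoly_derivation :: "nat \<Rightarrow> (cmpoly \<Rightarrow> cmpoly) \<Rightarrow> bool" where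
  "mpoly_derivation n D \<longleftrightarrow>
     (\<forall>f \<in> mpolys n. D f \<in> mpolys n) \<and>
     (\<forall>f \<in> mpolys n. \<forall>g \<in> mpolys n. D (f + g) = D f + D g) \<and>
     (\<forall>c. \<forall>f \<in> mpolys n. D (Cst c * f) = Cst c * D f) \<and>
     (\<forall>f \<in> mpolys n. \<forall>g \<in> mpolys n. D (f * g) = D f * g + f * D g)"

definition cheb_T_derivation :: "nat \<Rightarrow> (cmpoly \<Rightarrow> cmpoly) \<Rightarrow> bool" where
  "cheb_T_derivation n D \<longleftrightarrow> mpoly_derivation n D \<and> D (Var 0) = 0 \<and>
     (\<forall>m \<in> {1..n}. D (Var m) =
        of_nat m * ((\<Sum>k = 1..m-1. Cst (1 - (-1) ^ k) * Var (m - k)) + Cst ((1 - (-1) ^ m) / 2) * Var 0))"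

definition cheb_U_derivation :: "nat \<Rightarrow> (cmpoly \<Rightarrow> cmpoly) \<Rightarrow> bool" where
  "cheb_U_derivation n D \<longleftrightarrow> mpoly_derivation n D \<and> D (Var 0) = 0 \<and>
     (\<forall>m \<in> {1..n}. D (Var m) =
        (\<Sum>k = 0..m-1. Cst ((1 + (-1) ^ (m - k + 1)) * (of_nat k + 1)) * Var k))"

text \<open>
  The generating functions are power series in \<open>t\<close> (\<^const>\<open>fps_X\<close>) whose coefficients are
  polynomials in \<open>x\<close> (\<open>[:0, 1:]\<close>). As the coefficients do not form a field, the quotient by
  \<open>1 - 2xt + t\<^sup>2\<close> is taken with \<^const>\<open>fps_right_inverse_constructor\<close>, starting from the
  inverse \<open>1\<close> of the constant coefficient.
\<close>

definition cheb_denom :: "complex poly fps" where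
  "cheb_denom = 1 - fps_const (2 * [:0, 1:]) * fps_X + fps_X ^ 2"

definition cheb_T :: "nat \<Rightarrow> complex poly" where
  "cheb_T n = fps_nth ((1 - fps_const [:0, 1:] * fps_X) * fps_right_inverse cheb_denom 1) n"

definition cheb_U :: "nat \<Rightarrow> complex poly" where
  "cheb_U n = fps_nth (fps_right_inverse cheb_denom 1) n"

lemma cheb_denom_mult_inverse: "cheb_denom * fps_right_inverse cheb_denom 1 = 1"
  by (rule fps_right_inverse) (simp add: cheb_denom_def)

lemma cheb_T_gen_fun: "cheb_denom * Abs_fps cheb_T = 1 - fps_const [:0, 1:] * fps_X"
proof -
  have "Abs_fps cheb_T = (1 - fps_const [:0, 1:] * fps_X) * fps_right_inverse cheb_denom 1"
    unfolding cheb_T_def by (simp add: fps_eq_iff)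
  then show ?thesis
    by (metis (no_types, lifting) cheb_denom_mult_inverse mult.left_commute mult.right_neutral)
qed

lemma cheb_U_gen_fun: "cheb_denom * Abs_fps cheb_U = 1"
proof -
  have "Abs_fps cheb_U = fps_right_inverse cheb_denom 1"
    unfolding cheb_U_def by (simp add: fps_eq_iff)
  then show ?thesis
    by (simp add: cheb_denom_mult_inverse)
qed


subsection \<open>Substitution is a ring homomorphism\<close>

locale scalar_hom =
  fixes h :: "complex \<Rightarrow> 'a::comm_ring_1"
  assumes h_0: "h 0 = 0" and h_1: "h 1 = 1"
    and h_add: "h (c + d) = h c + h d" and h_mult: "h (c * d) = h c * h d"
begin

lemma mpoly_eval_superset:
  assumes "finite A" "Poly_Mapping.keys P \<subseteq> A"
  shows "mpoly_eval h a P = (\<Sum>m \<in> A.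
     h (Poly_Mapping.lookup P m) * (\<Prod>i \<in> Poly_Mapping.keys m. a i ^ Poly_Mapping.lookup m i))"
  unfolding mpoly_eval_def
  by (rule sum.mono_neutral_left[OF assms]) (auto simp: in_keys_iff h_0)

lemma mpoly_eval_0: "mpoly_eval h a 0 = 0"
  by (simp add: mpoly_eval_def)

lemma mpoly_eval_add: "mpoly_eval h a (P + Q) = mpoly_eval h a P + mpoly_eval h a Q"
proof -
  let ?A = "Poly_Mapping.keys P \<union> Poly_Mapping.keys Q"
  have 1: "Poly_Mapping.keys (P + Q) \<subseteq> ?A"
    by (rule Poly_Mapping.keys_add)
  show ?thesis
    using mpoly_eval_superset[of ?A "P + Q"] mpoly_eval_superset[of ?A P]
      mpoly_eval_superset[of ?A Q] 1
    by (simp add: lookup_add h_add distrib_right sum.distrib)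
qed

lemma mpoly_eval_sum: "mpoly_eval h a (sum f A) = (\<Sum>x\<in>A. mpoly_eval h a (f x))"
  by (induction A rule: infinite_finite_induct) (simp_all add: mpoly_eval_0 mpoly_eval_add)

lemma mpoly_eval_single: "mpoly_eval h a (Poly_Mapping.single m c) =
    h c * (\<Prod>i \<in> Poly_Mapping.keys m. a i ^ Poly_Mapping.lookup m i)"
  using mpoly_eval_superset[of "{m}" "Poly_Mapping.single m c" a] by simp

lemma mpoly_eval_Cst: "mpoly_eval h a (Cst c) = h c"
  by (simp add: Cst_def mpoly_eval_single)

lemma mpoly_eval_Var: "mpoly_eval h a (Var i) = a i"
  by (simp add: Var_def mpoly_eval_single h_1)

end

lemma cmpoly_eq_sum:
  fixes P :: cmpoly
  shows "P = (\<Sum>m \<in> Poly_Mapping.keys P. Poly_Mapping.single m (Poly_Mapping.lookup P m))"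
  by (rule poly_mapping_eqI)
     (auto simp: lookup_sum lookup_single when_def in_keys_iff sum.delta)

lemma monom_eval_add:
  fixes a :: "nat \<Rightarrow> 'a::comm_ring_1"
  shows "(\<Prod>i \<in> Poly_Mapping.keys (m + m'). a i ^ Poly_Mapping.lookup (m + m') i) =
    (\<Prod>i \<in> Poly_Mapping.keys m. a i ^ Poly_Mapping.lookup m i) *
    (\<Prod>i \<in> Poly_Mapping.keys m'. a i ^ Poly_Mapping.lookup m' i)"
proof -
  let ?A = "Poly_Mapping.keys m \<union> Poly_Mapping.keys m'"
  have *: "(\<Prod>i \<in> Poly_Mapping.keys k. a i ^ Poly_Mapping.lookup k i) =
      (\<Prod>i \<in> ?A. a i ^ Poly_Mapping.lookup k i)" if "Poly_Mapping.keys k \<subseteq> ?A" for k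
    by (rule prod.mono_neutral_left) (use that in \<open>auto simp: in_keys_iff\<close>)
  show ?thesis
    using *[of m] *[of m'] *[of "m + m'"] Poly_Mapping.keys_add[of m m']
    by (simp add: lookup_add power_add prod.distrib)
qed

lemma (in scalar_hom) mpoly_eval_mult:
  "mpoly_eval h a (P * Q) = mpoly_eval h a P * mpoly_eval h a Q"
proof -
  let ?S = "\<lambda>P :: cmpoly. \<Sum>m \<in> Poly_Mapping.keys P.
      Poly_Mapping.single m (Poly_Mapping.lookup P m)"
  have "P * Q = ?S P * ?S Q"
    by (simp only: cmpoly_eq_sum[symmetric])
  then have "P * Q = (\<Sum>m \<in> Poly_Mapping.keys P. \<Sum>m' \<in> Poly_Mapping.keys Q.
      Poly_Mapping.single (m + m') (Poly_Mapping.lookup P m * Poly_Mapping.lookup Q m'))"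
    by (simp only: sum_product mult_single)
  then have "mpoly_eval h a (P * Q) =
     (\<Sum>m \<in> Poly_Mapping.keys P. \<Sum>m' \<in> Poly_Mapping.keys Q.
       mpoly_eval h a (Poly_Mapping.single (m + m')
         (Poly_Mapping.lookup P m * Poly_Mapping.lookup Q m')))"
    by (simp add: mpoly_eval_sum)
  also have "\<dots> = mpoly_eval h a P * mpoly_eval h a Q"
    unfolding mpoly_eval_single monom_eval_add h_mult mpoly_eval_def[of h a P]
      mpoly_eval_def[of h a Q] sum_product
    by (simp only: mult_ac)
  finally show ?thesis .
qed


subsection \<open>Existence of derivations with prescribed values\<close>

lemma mpolys_0: "0 \<in> mpolys n"
  by (simp add: mpolys_def)

lemma mpolys_Cst: "Cst c \<in> mpolys n"
  by (simp add: mpolys_def Cst_def)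

lemma mpolys_1: "1 \<in> mpolys n"
  using mpolys_Cst[of 1 n] by (simp add: Cst_def)

lemma mpolys_of_nat: "of_nat k \<in> mpolys n"
  using mpolys_Cst[of "of_nat k" n] by (simp add: Cst_def)

lemma mpolys_Var: "i \<le> n \<Longrightarrow> Var i \<in> mpolys n"
  by (simp add: mpolys_def Var_def)

lemma mpolys_add: "P \<in> mpolys n \<Longrightarrow> Q \<in> mpolys n \<Longrightarrow> P + Q \<in> mpolys n"
  unfolding mpolys_def using Poly_Mapping.keys_add[of P Q] by blast

lemma mpolys_sum: "(\<And>x. x \<in> A \<Longrightarrow> f x \<in> mpolys n) \<Longrightarrow> sum f A \<in> mpolys n"
  by (induction A rule: infinite_finite_induct) (auto simp: mpolys_0 mpolys_add)

lemma mpolys_mult: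
  assumes "P \<in> mpolys n" "Q \<in> mpolys n"
  shows "P * Q \<in> mpolys n"
  unfolding mpolys_def
proof (intro CollectI ballI)
  fix m assume "m \<in> Poly_Mapping.keys (P * Q)"
  then obtain p q where pq: "m = p + q" "p \<in> Poly_Mapping.keys P" "q \<in> Poly_Mapping.keys Q"
    using keys_mult[of P Q] by blast
  then show "Poly_Mapping.keys m \<subseteq> {0..n}"
    using assms Poly_Mapping.keys_add[of p q] unfolding mpolys_def by blast
qed

text \<open>
  Since \<open>x\<^sub>i \<mapsto> x\<^sub>i + \<epsilon> v\<^sub>i\<close> is a ring homomorphism, its linear coefficient in \<open>\<epsilon>\<close> is a derivation.
\<close>

lemma ex_mpoly_derivation:
  assumes v: "\<And>i. i \<le> n \<Longrightarrow> v i \<in> mpolys n"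
  shows "\<exists>D. mpoly_derivation n D \<and> (\<forall>i\<le>n. D (Var i) = v i)"
proof -
  define h :: "complex \<Rightarrow> cmpoly poly" where "h = (\<lambda>c. [:Cst c:])"
  define E where "E = mpoly_eval h (\<lambda>i. [:Var i, v i:])"
  interpret scalar_hom h
    by unfold_locales
       (simp_all add: h_def Cst_def Poly_Mapping.single_add mult_single one_pCons mult.commute)
  interpret S: scalar_hom Cst
    by unfold_locales (simp_all add: Cst_def Poly_Mapping.single_add mult_single)
  define R where "R = {p. \<forall>k. poly.coeff p k \<in> mpolys n}"
  have R_0: "0 \<in> R" by (simp add: R_def mpolys_0)
  have R_add: "p + q \<in> R" if "p \<in> R" "q \<in> R" for p q
    using that by (simp add: R_def mpolys_add)
  have R_mult: "p * q \<in> R" if "p \<in> R" "q \<in> R" for p q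
    using that by (auto simp: R_def coeff_mult intro!: mpolys_sum mpolys_mult)
  have R_1: "1 \<in> R" using mpolys_0[of n] mpolys_1[of n]
    by (auto simp: R_def coeff_pCons one_pCons split: nat.splits)
  have R_h: "h c \<in> R" for c
    by (auto simp: R_def h_def coeff_pCons mpolys_Cst mpolys_0 split: nat.splits)
  have R_X: "[:Var i, v i:] \<in> R" if "i \<le> n" for i
    using that by (auto simp: R_def coeff_pCons mpolys_Var v mpolys_0 split: nat.splits)
  have R_pow: "p ^ k \<in> R" if "p \<in> R" for p k
    using that by (induction k) (auto simp: R_1 R_mult)
  have R_prod: "prod f A \<in> R" if "\<And>x. x \<in> A \<Longrightarrow> f x \<in> R" for f and A :: "nat set"
    using that by (induction A rule: infinite_finite_induct) (auto simp: R_1 R_mult)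
  have R_sum: "sum f A \<in> R" if "\<And>x. x \<in> A \<Longrightarrow> f x \<in> R" for f and A :: "(nat \<Rightarrow>\<^sub>0 nat) set"
    using that by (induction A rule: infinite_finite_induct) (auto simp: R_0 R_add)
  have E_R: "E P \<in> R" if "P \<in> mpolys n" for P
    unfolding E_def mpoly_eval_def
    by (intro R_sum R_mult R_h R_prod R_pow R_X) (use that in \<open>force simp: mpolys_def\<close>)
  have coeff_0: "poly.coeff (E P) 0 = P" for P
  proof -
    have "poly.coeff (E P) 0 = mpoly_eval Cst Var P"
      by (simp add: E_def mpoly_eval_def h_def poly_0_coeff_0[symmetric] poly_sum poly_mult
          poly_prod poly_power)
    also have "\<dots> = P"
    proof -
      have mon: "(\<Prod>i \<in> Poly_Mapping.keys m. Var i ^ Poly_Mapping.lookup m i)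
          = Poly_Mapping.single m 1" for m
      proof -
        have pow: "Var i ^ k = Poly_Mapping.single (Poly_Mapping.single i k) 1" for i k
          by (induction k) (simp_all add: Var_def mult_single Poly_Mapping.single_add[symmetric])
        have prd: "(\<Prod>i \<in> A. Poly_Mapping.single (g i) (1::complex))
            = Poly_Mapping.single (sum g A) 1" for g :: "nat \<Rightarrow> nat \<Rightarrow>\<^sub>0 nat" and A
          by (induction A rule: infinite_finite_induct) (simp_all add: mult_single)
        have "m = (\<Sum>i \<in> Poly_Mapping.keys m. Poly_Mapping.single i (Poly_Mapping.lookup m i))"
          by (rule poly_mapping_eqI)
             (auto simp: lookup_sum lookup_single when_def in_keys_iff sum.delta)
        then show ?thesis by (simp add: pow prd)
      qed
      show ?thesis
        by (subst (2) cmpoly_eq_sum[of P])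
           (simp add: mpoly_eval_def mon Cst_def mult_single)
    qed
    finally show ?thesis .
  qed
  have E_mult: "E (P * Q) = E P * E Q" and E_add: "E (P + Q) = E P + E Q" for P Q
    by (simp_all add: E_def mpoly_eval_mult mpoly_eval_add)
  have E_Cst: "E (Cst c) = [:Cst c:]" for c
    unfolding E_def mpoly_eval_Cst by (simp add: h_def)
  have E_X: "E (Var i) = [:Var i, v i:]" for i
    unfolding E_def mpoly_eval_Var by simp
  define D where "D = (\<lambda>P. poly.coeff (E P) 1)"
  have "mpoly_derivation n D"
    unfolding mpoly_derivation_def D_def
    using E_R by (auto simp: E_add E_mult E_Cst R_def coeff_mult coeff_0 algebra_simps)
  moreover have "D (Var i) = v i" for i
    by (simp add: D_def E_X)
  ultimately show ?thesis by blast
qed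

lemma ex_cheb_T_derivation: "\<exists>D. cheb_T_derivation n D"
proof -
  define v where "v = (\<lambda>m. if m = 0 then 0 else
    of_nat m * ((\<Sum>k = 1..m-1. Cst (1 - (-1) ^ k) * Var (m - k)) + Cst ((1 - (-1) ^ m) / 2) * Var 0))"
  have "v m \<in> mpolys n" if "m \<le> n" for m
    using that unfolding v_def
    by (auto intro!: mpolys_0 mpolys_mult mpolys_add mpolys_sum mpolys_of_nat mpolys_Cst mpolys_Var)
  from ex_mpoly_derivation[of n v, OF this] obtain D
    where D: "mpoly_derivation n D" "\<And>i. i \<le> n \<Longrightarrow> D (Var i) = v i" by blast
  have "cheb_T_derivation n D"
    unfolding cheb_T_derivation_def using D by (auto simp: v_def)
  then show ?thesis by blast
qed

lemma ex_cheb_U_derivation: "\<exists>D. cheb_U_derivation n D"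
proof -
  define v where "v = (\<lambda>m. if m = 0 then 0 else
    (\<Sum>k = 0..m-1. Cst ((1 + (-1) ^ (m - k + 1)) * (of_nat k + 1)) * Var k))"
  have "v m \<in> mpolys n" if "m \<le> n" for m
    using that unfolding v_def
    by (auto intro!: mpolys_0 mpolys_mult mpolys_sum mpolys_Cst mpolys_Var)
  from ex_mpoly_derivation[of n v, OF this] obtain D
    where D: "mpoly_derivation n D" "\<And>i. i \<le> n \<Longrightarrow> D (Var i) = v i" by blast
  have "cheb_U_derivation n D"
    unfolding cheb_U_derivation_def using D by (auto simp: v_def)
  then show ?thesis by blast
qed

end

theory Submission
  imports Defs
begin

text \<open>
  Substituting Chebyshev polynomials turns the Chebyshev derivations into \<open>d/dx\<close>: the chain rule
  reduces this to the variables, where it is the expansion of \<open>T\<^sub>m'\<close> in the \<open>T\<^sub>k\<close>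
  (respectively of \<open>U\<^sub>m'\<close> in the \<open>U\<^sub>k\<close>). Both expansions follow from \<open>T\<^sub>m' = m U\<^sub>m\<^sub>-\<^sub>1\<close> and
  \<open>U\<^sub>m - U\<^sub>m\<^sub>-\<^sub>2 = 2 T\<^sub>m\<close>. So a polynomial in the kernel is sent to a polynomial with zero derivative.
\<close>

subsection \<open>Derivations and substitution\<close>

lemma single_eq_prod_Var:
  "Poly_Mapping.single m c =
     Cst c * (\<Prod>i \<in> Poly_Mapping.keys m. Var i ^ Poly_Mapping.lookup m i)"
proof -
  have pow: "Var i ^ k = Poly_Mapping.single (Poly_Mapping.single i k) 1" for i k
    by (induction k) (simp_all add: Var_def mult_single Poly_Mapping.single_add[symmetric])
  have prd: "(\<Prod>i \<in> A. Poly_Mapping.single (g i) (1::complex)) = Poly_Mapping.single (sum g A) 1"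
    for g :: "nat \<Rightarrow> nat \<Rightarrow>\<^sub>0 nat" and A
    by (induction A rule: infinite_finite_induct) (simp_all add: mult_single)
  have "m = (\<Sum>i \<in> Poly_Mapping.keys m. Poly_Mapping.single i (Poly_Mapping.lookup m i))"
    by (rule poly_mapping_eqI)
       (auto simp: lookup_sum lookup_single when_def in_keys_iff sum.delta)
  then show ?thesis
    by (simp add: pow prd Cst_def mult_single)
qed

text \<open>Constants and the variables up to \<open>n\<close> generate \<open>mpolys n\<close> as a
  ring, since each monomial is a product of variable powers by
  \<open>single_eq_prod_Var\<close>.\<close>

lemma mpolys_induct [consumes 1, case_names Cst Var add mult]:
  assumes P: "P \<in> mpolys n"
    and Cst: "\<And>c. Q (Cst c)"
    and Var: "\<And>i. i \<le> n \<Longrightarrow> Q (Var i)"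
    and add: "\<And>f g. f \<in> mpolys n \<Longrightarrow> g \<in> mpolys n \<Longrightarrow> Q f \<Longrightarrow> Q g \<Longrightarrow> Q (f + g)"
    and mult: "\<And>f g. f \<in> mpolys n \<Longrightarrow> g \<in> mpolys n \<Longrightarrow> Q f \<Longrightarrow> Q g \<Longrightarrow> Q (f * g)"
  shows "Q P"
proof -
  \<comment> \<open>Membership is carried along with \<open>Q\<close>, because \<open>add\<close>
    and \<open>mult\<close> may only be applied inside \<open>mpolys n\<close>.\<close>
  define R where "R f \<longleftrightarrow> f \<in> mpolys n \<and> Q f" for f
  have R_Cst: "R (Cst c)" for c
    by (simp add: R_def mpolys_Cst Cst)
  have R_0: "R 0" and R_1: "R 1"
    using R_Cst[of 0] R_Cst[of 1] by (simp_all add: Cst_def)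
  have R_mult: "R (f * g)" if "R f" "R g" for f g
    using that by (simp add: R_def mpolys_mult mult)
  have R_pow: "R (f ^ k)" if "R f" for f k
    using that by (induction k) (auto simp: R_1 R_mult)
  have R_prod: "R (prod f A)" if "\<And>i. i \<in> A \<Longrightarrow> R (f i)" for f and A :: "nat set"
    using that by (induction A rule: infinite_finite_induct) (auto simp: R_1 R_mult)
  have R_sum: "R (sum f A)" if "\<And>m. m \<in> A \<Longrightarrow> R (f m)" for f and A :: "(nat \<Rightarrow>\<^sub>0 nat) set"
    using that by (induction A rule: infinite_finite_induct)
      (simp_all add: R_0, simp add: R_def mpolys_add add)
  have "R (Poly_Mapping.single m c)" if "m \<in> Poly_Mapping.keys P" for m c
    unfolding single_eq_prod_Var
  proof (intro R_mult R_Cst R_prod R_pow)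
    fix i assume "i \<in> Poly_Mapping.keys m"
    then have "i \<le> n" using P that by (force simp: mpolys_def)
    then show "R (Var i)" by (simp add: R_def mpolys_Var Var)
  qed
  then have "R P"
    by (subst cmpoly_eq_sum) (rule R_sum)
  then show ?thesis by (simp add: R_def)
qed

interpretation const_poly: scalar_hom "\<lambda>z :: complex. [:z:]"
  by unfold_locales (simp_all add: one_pCons)

abbreviation poly_subst :: "(nat \<Rightarrow> complex poly) \<Rightarrow> cmpoly \<Rightarrow> complex poly" where
  "poly_subst \<equiv> mpoly_eval (\<lambda>z. [:z:])"

text \<open>The Leibniz rule at \<open>1 * 1\<close> forces \<open>D 1 = 0\<close>; linearity does
  the rest.\<close>

lemma mpoly_derivation_Cst:
  assumes "mpoly_derivation n D"
  shows "D (Cst c) = 0"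
proof -
  have "D (1 * 1) = D 1 * 1 + 1 * D 1"
    using assms mpolys_1[of n] unfolding mpoly_derivation_def by blast
  then have "D 1 = 0" by simp
  moreover have "D (Cst c * 1) = Cst c * D 1"
    using assms mpolys_1[of n] unfolding mpoly_derivation_def by blast
  ultimately show ?thesis by simp
qed

text \<open>Both sides are additive and obey the same Leibniz rule over the substitution
  homomorphism, so agreement on generators suffices.\<close>

lemma pderiv_poly_subst:
  assumes D: "mpoly_derivation n D"
    and "P \<in> mpolys n"
    and a: "\<And>i. i \<le> n \<Longrightarrow> pderiv (a i) = poly_subst a (D (Var i))"
  shows "pderiv (poly_subst a P) = poly_subst a (D P)"
  using assms(2)
proof (induction rule: mpolys_induct)
  case (Cst c)
  show ?case
    by (simp add: mpoly_derivation_Cst[OF D] const_poly.mpoly_eval_Cst const_poly.mpoly_eval_0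
        pderiv_pCons)
next
  case (Var i)
  then show ?case by (simp add: const_poly.mpoly_eval_Var a)
next
  case (add f g)
  then have "D (f + g) = D f + D g"
    using D unfolding mpoly_derivation_def by blast
  then show ?case
    by (simp add: const_poly.mpoly_eval_add pderiv_add add.IH)
next
  case (mult f g)
  then have "D (f * g) = D f * g + f * D g"
    using D unfolding mpoly_derivation_def by blast
  then show ?case
    by (simp add: const_poly.mpoly_eval_add const_poly.mpoly_eval_mult pderiv_mult mult.IH
        algebra_simps)
qed

subsection \<open>Chebyshev polynomials\<close>

text \<open>Stated for arbitrary \<open>F\<close>, so that coefficients can be compared in both
  generating function identities.\<close>

lemma cheb_denom_mult_nth:
  "fps_nth (cheb_denom * F) (Suc (Suc n)) =
     fps_nth F (Suc (Suc n)) - [:0, 2:] * fps_nth F (Suc n) + fps_nth F n"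
  "fps_nth (cheb_denom * F) (Suc 0) = fps_nth F (Suc 0) - [:0, 2:] * fps_nth F 0"
  "fps_nth (cheb_denom * F) 0 = fps_nth F 0"
proof -
  have 2: "(2 :: complex poly) * [:0, 1:] = [:0, 2:]"
    by (simp add: numeral_poly)
  have "cheb_denom * F = F - fps_const [:0, 2:] * (fps_X * F) + fps_X * (fps_X * F)"
    unfolding cheb_denom_def 2 by (simp add: algebra_simps power2_eq_square)
  then show
    "fps_nth (cheb_denom * F) (Suc (Suc n)) =
       fps_nth F (Suc (Suc n)) - [:0, 2:] * fps_nth F (Suc n) + fps_nth F n"
    "fps_nth (cheb_denom * F) (Suc 0) = fps_nth F (Suc 0) - [:0, 2:] * fps_nth F 0"
    "fps_nth (cheb_denom * F) 0 = fps_nth F 0"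
    by simp_all
qed

lemma cheb_U_0 [simp]: "cheb_U 0 = 1"
  using cheb_denom_mult_nth(3)[of "Abs_fps cheb_U"] by (simp add: cheb_U_gen_fun)

lemma cheb_U_1 [simp]: "cheb_U (Suc 0) = [:0, 2:]"
  using cheb_denom_mult_nth(2)[of "Abs_fps cheb_U"] by (simp add: cheb_U_gen_fun)

lemma cheb_U_Suc_Suc: "cheb_U (Suc (Suc n)) = [:0, 2:] * cheb_U (Suc n) - cheb_U n"
  using cheb_denom_mult_nth(1)[of "Abs_fps cheb_U" n]
  by (simp add: cheb_U_gen_fun algebra_simps)

lemma cheb_T_0 [simp]: "cheb_T 0 = 1"
  using cheb_denom_mult_nth(3)[of "Abs_fps cheb_T"] by (simp add: cheb_T_gen_fun)

text \<open>The generating function of \<open>cheb_T\<close> is \<open>1 - xt\<close> times that of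
  \<open>cheb_U\<close>.\<close>

lemma cheb_T_Suc: "cheb_T (Suc n) = cheb_U (Suc n) - [:0, 1:] * cheb_U n"
proof -
  let ?U = "fps_right_inverse cheb_denom 1"
  have "(1 - fps_const [:0, 1:] * fps_X) * ?U = ?U - fps_const [:0, 1:] * (fps_X * ?U)"
    by (simp add: algebra_simps)
  then show ?thesis by (simp add: cheb_T_def cheb_U_def)
qed

lemma cheb_T_1: "cheb_T (Suc 0) = [:0, 1:]"
  by (simp add: cheb_T_Suc)

text \<open>Leaves \<open>[:0, 1:]\<close> as the only atom for x, so that the identities below
  become pure ring algebra.\<close>

lemma double_X: "[:0, 2:] = 2 * ([:0, 1:] :: complex poly)"
  by (simp add: numeral_poly)

lemma cheb_U_Suc_Suc_minus: "cheb_U (Suc (Suc n)) - cheb_U n = 2 * cheb_T (Suc (Suc n))"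
  unfolding cheb_T_Suc cheb_U_Suc_Suc double_X by algebra

text \<open>The recurrence starts at index 3 because \<open>cheb_T_Suc\<close> covers positive
  indices only.\<close>

lemma cheb_T_Suc_Suc_Suc:
  "cheb_T (Suc (Suc (Suc n))) = 2 * [:0, 1:] * cheb_T (Suc (Suc n)) - cheb_T (Suc n)"
  unfolding cheb_T_Suc cheb_U_Suc_Suc double_X by algebra

text \<open>Differentiate the three-term recurrence and insert both induction hypotheses; what
  remains is an identity in \<open>cheb_U\<close> modulo its recurrence.\<close>

lemma pderiv_cheb_T: "pderiv (cheb_T (Suc n)) = of_nat (Suc n) * cheb_U n"
proof (induction n rule: induct_nat_012)
  case 0
  show ?case by (simp add: cheb_T_1 pderiv_pCons one_pCons)
next
  case 1
  show ?case
    by (simp add: cheb_T_Suc cheb_U_Suc_Suc pderiv_diff pderiv_mult pderiv_pCons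
        one_pCons numeral_poly)
next
  case (ge2 n)
  have X: "pderiv (2 * [:0, 1:]) = (2 :: complex poly)"
    by (simp add: pderiv_pCons numeral_poly)
  have "pderiv (cheb_T (Suc (Suc (Suc n)))) =
      2 * cheb_T (Suc (Suc n)) + 2 * [:0, 1:] * (of_nat (Suc (Suc n)) * cheb_U (Suc n))
      - of_nat (Suc n) * cheb_U n"
    unfolding cheb_T_Suc_Suc_Suc pderiv_diff pderiv_mult[of "2 * [:0, 1:]"] ge2 X by (simp only: ac_simps)
  also have "\<dots> = of_nat (Suc (Suc (Suc n))) * cheb_U (Suc (Suc n))"
    unfolding cheb_T_Suc[of "Suc n"] cheb_U_Suc_Suc double_X of_nat_Suc by algebra
  finally show ?case .
qed

lemma pderiv_cheb_U_Suc_Suc: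
  "pderiv (cheb_U (Suc (Suc n))) = pderiv (cheb_U n) + 2 * of_nat (n + 2) * cheb_U (Suc n)"
proof -
  \<comment> \<open>The factor 2 is written as a repeated summand so that \<open>pderiv_add\<close>
    alone differentiates the right side.\<close>
  have "cheb_U (Suc (Suc n)) = cheb_U n + (cheb_T (Suc (Suc n)) + cheb_T (Suc (Suc n)))"
    using cheb_U_Suc_Suc_minus[of n] by (simp add: algebra_simps)
  then have "pderiv (cheb_U (Suc (Suc n))) = pderiv (cheb_U n)
      + (pderiv (cheb_T (Suc (Suc n))) + pderiv (cheb_T (Suc (Suc n))))"
    by (simp only: pderiv_add)
  then show ?thesis
    by (simp add: pderiv_cheb_T algebra_simps)
qed

text \<open>Telescopes \<open>cheb_U_Suc_Suc_minus\<close> in steps of two. The coefficients keep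
  the form used in \<open>cheb_T_derivation\<close>; the last constant is the \<open>T_0\<close>
  term, which is 1 for even \<open>m\<close> and 0 for odd \<open>m\<close>.\<close>

lemma cheb_U_eq_sum_cheb_T:
  "cheb_U m = (\<Sum>k = 1..m. [:1 - (-1) ^ k:] * cheb_T (Suc m - k)) + [:(1 - (-1) ^ Suc m) / 2:]"
proof (induction m rule: induct_nat_012)
  case 0
  show ?case by (simp add: one_pCons)
next
  case 1
  show ?case by (simp add: cheb_T_1)
next
  case (ge2 m)
  define F where "F m k = [:1 - (-1) ^ k:] * cheb_T (Suc m - k)" for m k
  \<comment> \<open>Since \<open>k\<close> counts down from the top degree, the new terms are the
    first two, and the rest is the old sum shifted by two.\<close>
  have "(\<Sum>k = 1..Suc (Suc m). F (Suc (Suc m)) k)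
      = F (Suc (Suc m)) 1 + F (Suc (Suc m)) 2 + (\<Sum>k = Suc (Suc 1)..Suc (Suc m). F (Suc (Suc m)) k)"
    using sum.atLeast_Suc_atMost[of 1 "Suc (Suc m)" "F (Suc (Suc m))"]
      sum.atLeast_Suc_atMost[of "Suc 1" "Suc (Suc m)" "F (Suc (Suc m))"]
    by (simp add: numeral_2_eq_2 add.assoc del: sum.cl_ivl_Suc)
  also have "(\<Sum>k = Suc (Suc 1)..Suc (Suc m). F (Suc (Suc m)) k) = (\<Sum>k = 1..m. F m k)"
    unfolding sum.shift_bounds_cl_Suc_ivl by (simp add: F_def)
  also have "F (Suc (Suc m)) 1 = 2 * cheb_T (Suc (Suc m))"
    by (simp add: F_def numeral_poly)
  also have "F (Suc (Suc m)) 2 = 0"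
    by (simp add: F_def)
  finally show ?case
    using cheb_U_Suc_Suc_minus[of m] ge2(1) by (simp add: F_def algebra_simps)
qed

text \<open>Telescopes \<open>pderiv_cheb_U_Suc_Suc\<close>: passing from \<open>m\<close> to
  \<open>m + 2\<close> preserves the parity of \<open>m - k\<close>, so old terms stay and new ones
  appear at the top.\<close>

lemma pderiv_cheb_U:
  "pderiv (cheb_U m) = (\<Sum>k<m. [:(1 + (-1) ^ (m - k + 1)) * (of_nat k + 1):] * cheb_U k)"
proof (induction m rule: induct_nat_012)
  case 0
  show ?case by simp
next
  case 1
  show ?case by (simp add: pderiv_pCons)
next
  case (ge2 m)
  define F where "F m k = [:(1 + (-1) ^ (m - k + 1)) * (of_nat k + 1):] * cheb_U k" for m k
  have "F (Suc (Suc m)) k = F m k" if "k < m" for k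
    using that by (simp add: F_def Suc_diff_le)
  moreover have "F (Suc (Suc m)) (Suc m) = 2 * of_nat (m + 2) * cheb_U (Suc m)"
    by (simp add: F_def of_nat_poly numeral_poly algebra_simps)
  moreover have "F (Suc (Suc m)) m = 0"
    by (simp add: F_def Suc_diff_le)
  ultimately show ?case
    unfolding pderiv_cheb_U_Suc_Suc ge2(1) F_def[symmetric] by simp
qed

section \<open>The Chebyshev derivations become d/dx under substitution\<close>

lemma pderiv_poly_subst_cheb_T:
  assumes D: "cheb_T_derivation n D" and "P \<in> mpolys n"
  shows "pderiv (poly_subst cheb_T P) = poly_subst cheb_T (D P)"
proof (rule pderiv_poly_subst[OF _ assms(2)])
  show "mpoly_derivation n D"
    using D by (simp add: cheb_T_derivation_def)
  fix i assume "i \<le> n"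
  show "pderiv (cheb_T i) = poly_subst cheb_T (D (Var i))"
  proof (cases i)
    case 0
    then show ?thesis
      using D by (simp add: cheb_T_derivation_def const_poly.mpoly_eval_0)
  next
    case (Suc m)
    \<comment> \<open>As a constant polynomial, the factor \<open>m\<close> is evaluated by
      \<open>mpoly_eval_Cst\<close>.\<close>
    have of_nat_Cst: "(of_nat k :: cmpoly) = Cst (of_nat k)" for k
      by (simp add: Cst_def)
    have "D (Var i) = Cst (of_nat (Suc m)) * ((\<Sum>k = 1..m. Cst (1 - (-1) ^ k) * Var (Suc m - k))
        + Cst ((1 - (-1) ^ Suc m) / 2) * Var 0)"
      using D \<open>i \<le> n\<close> unfolding cheb_T_derivation_def of_nat_Cst Suc by auto
    then have "poly_subst cheb_T (D (Var i)) = [:of_nat (Suc m):] * cheb_U m"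
      by (simp only: cheb_U_eq_sum_cheb_T[of m] const_poly.mpoly_eval_mult const_poly.mpoly_eval_add
        const_poly.mpoly_eval_sum const_poly.mpoly_eval_Cst const_poly.mpoly_eval_Var
        cheb_T_0 mult_1_right)
    then show ?thesis
      unfolding Suc pderiv_cheb_T by (simp only: of_nat_poly)
  qed
qed

lemma pderiv_poly_subst_cheb_U:
  assumes D: "cheb_U_derivation n D" and "P \<in> mpolys n"
  shows "pderiv (poly_subst cheb_U P) = poly_subst cheb_U (D P)"
proof (rule pderiv_poly_subst[OF _ assms(2)])
  show "mpoly_derivation n D"
    using D by (simp add: cheb_U_derivation_def)
  fix i assume "i \<le> n"
  show "pderiv (cheb_U i) = poly_subst cheb_U (D (Var i))"
  proof (cases "i = 0")
    case True
    then show ?thesis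
      using D by (simp add: cheb_U_derivation_def const_poly.mpoly_eval_0)
  next
    case False
    \<comment> \<open>This holds only for positive \<open>i\<close>: at 0, truncated subtraction
      would leave \<open>{0}\<close>.\<close>
    then have "{0..i - 1} = {..<i}" by auto
    then have "D (Var i) = (\<Sum>k<i. Cst ((1 + (-1) ^ (i - k + 1)) * (of_nat k + 1)) * Var k)"
      using D \<open>i \<le> n\<close> False unfolding cheb_U_derivation_def by auto
    then show ?thesis
      by (simp only: pderiv_cheb_U const_poly.mpoly_eval_mult const_poly.mpoly_eval_sum
          const_poly.mpoly_eval_Cst const_poly.mpoly_eval_Var)
  qed
qed

text \<open>In characteristic zero a vanishing derivative forces degree zero.\<close>

lemma pderiv_eq_0_imp_const:
  fixes p :: "complex poly"
  assumes "pderiv p = 0"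
  shows "\<exists>c. p = [:c:]"
  using assms degree_eq_zeroE[of p] by (auto simp: pderiv_eq_0_iff)

theorem mainTheorem1:
  fixes n :: nat and P :: cmpoly and D_T D_U :: "cmpoly \<Rightarrow> cmpoly"
  assumes "P \<in> mpolys n"
    and "cheb_T_derivation n D_T"
    and "cheb_U_derivation n D_U"
  shows "(D_T P = 0 \<longrightarrow> (\<exists>c. mpoly_eval (\<lambda>z. [:z:]) cheb_T P = [:c:])) \<and>
         (D_U P = 0 \<longrightarrow> (\<exists>c. mpoly_eval (\<lambda>z. [:z:]) cheb_U P = [:c:]))"
  using pderiv_poly_subst_cheb_T[OF assms(2,1)] pderiv_poly_subst_cheb_U[OF assms(3,1)]
  by (auto simp: const_poly.mpoly_eval_0 intro!: pderiv_eq_0_imp_const)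

end
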